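(* Let $F_1(\mathbf{x}_1),\dotsc,F_k(\mathbf{x}_k)$ be homogeneous forms of degree $d$ over $\mathbb{C}$ in independent tuples of variables $\mathbf{x}_1,\dotsc,\mathbf{x}_k$, and let $F = F_1 + \dotsb + F_k$. Suppose there is an integer $a$, $1 \leq a \leq d-1$, such that for each $i$, $1 \leq i \leq k$, $\operatorname{rk}(F_i) = \dim \operatorname{Derivs}(F_i)_a$. Then $$\operatorname{rk}(F) = \dim \operatorname{Derivs}(F)_a = \operatorname{rk}(F_1) + \dotsb + \operatorname{rk}(F_k).$$ If in addition $a \geq 2$, then furthermore every Waring decomposition of $F$ is a sum of Waring decompositions of the $F_i$'s. That is, if $F = \ell_1^d + \dotsb + \ell_r^d$ with $r=\operatorname{rk}(F)$ and $\ell_1,\dotsc,\ell_r$ linear forms in the variables $(\mathbf{x}_1,\dotsc,\mathbf{x}_k)$, then each $\ell_j$ only involves variables from one tuple $\mathbf{x}_i$, and the $\ell_j$ that involve variables from $\mathbf{x}_i$ give a Waring decomposition of $F_i$.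
   Context: All polynomials have complex coefficients. A form of degree $d$ (or $d$-form) is a homogeneous polynomial of degree $d$. Tuples of variables $\mathbf{x}_1,\dotsc,\mathbf{x}_k$ are independent if they consist of pairwise disjoint sets of variables of one polynomial ring. The Waring rank $\operatorname{rk}(F)$ of a $d$-form $F$ is the least $r$ such that $F = \ell_1^d + \dotsb + \ell_r^d$ for some linear forms $\ell_1,\dotsc,\ell_r$; such an expression with $r = \operatorname{rk}(F)$ is called a Waring decomposition of $F$. $\operatorname{Derivs}(F)$ denotes the graded vector space spanned by the partial derivatives of $F$ of all orders, including $F$ itself, and $\operatorname{Derivs}(F)_a$ is its degree $a$ graded piece, i.e. the space of $a$-forms spanned by the $(d-a)$th order partial derivatives of $F$. *)

theory Defs
  imports Complex_Main "HOL-Library.Poly_Mapping" "HOL-Library.Disjoint_Sets"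
begin

text \<open>
  The polynomial ring over the complex numbers whose variables are the elements of the type
  \<open>'v\<close>: a monomial is its finitely supported exponent vector, and a polynomial maps monomials
  to coefficients.  No finiteness of \<open>'v\<close> is required.
\<close>

type_synonym 'v cpoly = "('v \<Rightarrow>\<^sub>0 nat) \<Rightarrow>\<^sub>0 complex"

definition cpoly_scale :: "complex \<Rightarrow> 'v cpoly \<Rightarrow> 'v cpoly"
  where "cpoly_scale c p = Poly_Mapping.single 0 c * p"

global_interpretation cpoly: vector_space cpoly_scale
  by unfold_locales
    (simp_all add: cpoly_scale_def algebra_simps single_add mult_single
      flip: mult.assoc)

definition cpoly_vars :: "'v cpoly \<Rightarrow> 'v set"
  where "cpoly_vars p = (\<Union>m\<in>Poly_Mapping.keys p. Poly_Mapping.keys m)"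

definition mono_degree :: "('v \<Rightarrow>\<^sub>0 nat) \<Rightarrow> nat"
  where "mono_degree m = (\<Sum>v\<in>Poly_Mapping.keys m. Poly_Mapping.lookup m v)"

text \<open>As usual, the zero polynomial is a form of every degree.\<close>

definition is_form :: "nat \<Rightarrow> 'v cpoly \<Rightarrow> bool"
  where "is_form d p \<longleftrightarrow> (\<forall>m\<in>Poly_Mapping.keys p. mono_degree m = d)"

text \<open>
  The formal partial derivative.  The subtraction of exponents truncates at \<open>0\<close>, but only
  where the coefficient vanishes.
\<close>

definition cpoly_pderiv :: "'v \<Rightarrow> 'v cpoly \<Rightarrow> 'v cpoly"
  where "cpoly_pderiv v p =
    (\<Sum>m\<in>Poly_Mapping.keys p.
      Poly_Mapping.single (m - Poly_Mapping.single v 1)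
        (of_nat (Poly_Mapping.lookup m v) * Poly_Mapping.lookup p m))"

text \<open>
  A list of variables stands for the corresponding iterated partial derivative, its length for
  the order; the empty list yields the polynomial itself.
\<close>

definition Derivs :: "'v cpoly \<Rightarrow> 'v cpoly set"
  where "Derivs F = cpoly.span {fold cpoly_pderiv vs F | vs. True}"

definition Derivs_graded :: "'v cpoly \<Rightarrow> nat \<Rightarrow> 'v cpoly set"
  where "Derivs_graded F a = {G \<in> Derivs F. is_form a G}"

text \<open>
  The degree is an argument because \<open>0\<close> is a form of every degree.  For \<open>d \<ge> 1\<close> every
  \<open>d\<close>-form over the complex numbers is a sum of \<open>d\<close>-th powers of linear forms, so the least
  number exists.
\<close>

definition waring_rank :: "nat \<Rightarrow> 'v cpoly \<Rightarrow> nat"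
  where "waring_rank d F =
    (LEAST r. \<exists>l :: nat \<Rightarrow> 'v cpoly.
      (\<forall>j\<in>{1..r}. is_form 1 (l j)) \<and> F = (\<Sum>j\<in>{1..r}. l j ^ d))"

text \<open>The linear forms are indexed by an arbitrary finite set, so that subfamilies are covered.\<close>

definition waring_decomposition ::
    "nat \<Rightarrow> 'v cpoly \<Rightarrow> 'j set \<Rightarrow> ('j \<Rightarrow> 'v cpoly) \<Rightarrow> bool"
  where "waring_decomposition d F J l \<longleftrightarrow>
    finite J \<and> (\<forall>j\<in>J. is_form 1 (l j)) \<and> F = (\<Sum>j\<in>J. l j ^ d) \<and> card J = waring_rank d F"

end

theory Submission
  imports Defs
begin

text \<open>
  Let \<open>F = l\<^sub>1\<^sup>d + \<dots> + l\<^sub>r\<^sup>d\<close>.  Every derivative of \<open>F\<close> of order \<open>d - a\<close> is a linear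
  combination of the powers \<open>l\<^sub>j\<^sup>a\<close> (\<open>Derivs_graded_subset_span_powers\<close>), so the dimension
  of the degree \<open>a\<close> piece of the derivative space is at most the Waring rank.  The degree \<open>a\<close>
  piece for \<open>F\<close> contains those for the summands \<open>F\<^sub>i\<close>, and these are independent because they
  consist of forms of positive degree in disjoint sets of variables
  (\<open>sum_dim_Derivs_graded_le\<close>).  Finally, Waring decompositions of the \<open>F\<^sub>i\<close> add up to an
  expression of \<open>F\<close> (\<open>waring_rank_sum_le\<close>).  By the hypothesis on the \<open>F\<^sub>i\<close>, this closes a
  cycle of inequalities,
  \<open>rk F \<le> \<Sum> rk F\<^sub>i = \<Sum> dim Derivs(F\<^sub>i)\<^sub>a \<le> dim Derivs(F)\<^sub>a \<le> rk F\<close>,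
  and all of them are equalities.  The existence of Waring decompositions is needed on the way: it
  follows from polarization (\<open>form_in_power_span\<close>) and from the existence of complex roots.

  Now let \<open>r\<close> be the rank and \<open>a \<ge> 2\<close>.  The \<open>r\<close> powers \<open>l\<^sub>j\<^sup>a\<close> generate a space that
  contains the \<open>r\<close>-dimensional space \<open>Derivs(F)\<^sub>a\<close>, so they are a basis of it
  (\<open>generators_of_length_dim\<close>).  If \<open>x\<close> and \<open>y\<close> are variables of different tuples, then
  \<open>\<partial>\<^sub>x\<partial>\<^sub>y\<close> kills \<open>F\<close>, hence all derivatives of \<open>F\<close>, hence every \<open>l\<^sub>j\<^sup>a\<close>; but it does
  not kill the nonzero power \<open>l\<^sub>j\<^sup>a\<close> if \<open>x\<close> and \<open>y\<close> both occur in \<open>l\<^sub>j\<close>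
  (\<open>pderiv_pderiv_power_nonzero\<close>).  So each \<open>l\<^sub>j\<close> involves a single tuple.  Comparing
  the monomials in the \<open>i\<close>-th tuple shows that the corresponding \<open>l\<^sub>j\<^sup>d\<close> sum to \<open>F\<^sub>i\<close>, and
  as the ranks of the \<open>F\<^sub>i\<close> add up to \<open>r\<close>, each of these expressions has minimal length.
\<close>

section \<open>Coefficients, forms and variables\<close>

lemma lookup_cpoly_scale [simp]:
  "Poly_Mapping.lookup (cpoly_scale c p) m = c * Poly_Mapping.lookup p m"
  unfolding cpoly_scale_def
  by (simp add: mult_map_scale_conv_mult[symmetric] map.rep_eq "when_def")

lemma cpoly_scale_mult_left: "cpoly_scale c p * q = cpoly_scale c (p * q)"
  by (simp add: cpoly_scale_def mult.assoc)

lemma cpoly_scale_power: "cpoly_scale c p ^ n = cpoly_scale (c ^ n) (p ^ n)"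
proof (induction n)
  case (Suc n)
  then show ?case
    by (simp add: cpoly_scale_def mult_single[of 0 _ 0, simplified, symmetric] ac_simps)
qed simp

lemma mono_degree_superset:
  assumes "finite A" "Poly_Mapping.keys m \<subseteq> A"
  shows "mono_degree m = (\<Sum>v\<in>A. Poly_Mapping.lookup m v)"
  unfolding mono_degree_def using assms
  by (intro sum.mono_neutral_left) (auto simp: in_keys_iff)

lemma mono_degree_add: "mono_degree (m + n) = mono_degree m + mono_degree n"
proof -
  let ?A = "Poly_Mapping.keys m \<union> Poly_Mapping.keys n"
  show ?thesis
    using keys_add[of m n]
    by (simp add: mono_degree_superset[of ?A] lookup_add sum.distrib)
qed

lemma mono_degree_single [simp]: "mono_degree (Poly_Mapping.single v k) = k"
  by (simp add: mono_degree_superset[of "{v}"])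

lemma mono_degree_zero [simp]: "mono_degree 0 = 0"
  by (simp add: mono_degree_def)

lemma mono_degree_eq_0_iff: "mono_degree m = 0 \<longleftrightarrow> m = 0"
  by (auto simp: mono_degree_def in_keys_iff intro!: poly_mapping_eqI)

lemma monomial_split:
  fixes m :: "'v \<Rightarrow>\<^sub>0 nat"
  assumes "v \<in> Poly_Mapping.keys m"
  shows "m = (m - Poly_Mapping.single v 1) + Poly_Mapping.single v 1"
  using assms
  by (intro poly_mapping_eqI) (auto simp: lookup_add lookup_minus lookup_single "when_def" in_keys_iff)

lemma is_formD: "is_form d p \<Longrightarrow> Poly_Mapping.lookup p m \<noteq> 0 \<Longrightarrow> mono_degree m = d"
  by (simp add: is_form_def in_keys_iff)

lemma is_formI: "(\<And>m. Poly_Mapping.lookup p m \<noteq> 0 \<Longrightarrow> mono_degree m = d) \<Longrightarrow> is_form d p"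
  by (simp add: is_form_def in_keys_iff)

lemma is_form_0 [simp]: "is_form d 0"
  by (simp add: is_form_def)

lemma is_form_scale: "is_form d p \<Longrightarrow> is_form d (cpoly_scale c p)"
  by (rule is_formI) (auto dest: is_formD)

lemma is_form_add: "is_form d p \<Longrightarrow> is_form d q \<Longrightarrow> is_form d (p + q)"
  using keys_add[of p q] by (auto simp: is_form_def)

lemma is_form_sum: "(\<And>i. i \<in> I \<Longrightarrow> is_form d (p i)) \<Longrightarrow> is_form d (\<Sum>i\<in>I. p i)"
  using keys_sum[of p I] by (force simp: is_form_def)

lemma subspace_is_form: "cpoly.subspace {p. is_form d p}"
  by (auto simp: cpoly.subspace_def is_form_add is_form_scale)

lemma is_form_mult: "is_form d p \<Longrightarrow> is_form e q \<Longrightarrow> is_form (d + e) (p * q)"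
  using keys_mult[of p q] by (force simp: is_form_def mono_degree_add)

lemma is_form_power: "is_form 1 l \<Longrightarrow> is_form n (l ^ n)"
proof (induction n)
  case (Suc n)
  then show ?case using is_form_mult[of 1 l n "l ^ n"] by simp
qed (simp add: is_form_def)

lemma cpoly_varsI: "Poly_Mapping.lookup p m \<noteq> 0 \<Longrightarrow> v \<in> Poly_Mapping.keys m \<Longrightarrow> v \<in> cpoly_vars p"
  by (auto simp: cpoly_vars_def in_keys_iff)

lemma cpoly_varsE:
  assumes "v \<in> cpoly_vars p"
  obtains m where "Poly_Mapping.lookup p m \<noteq> 0" "v \<in> Poly_Mapping.keys m"
  using assms by (auto simp: cpoly_vars_def in_keys_iff)

lemma subspace_cpoly_vars: "cpoly.subspace {p. cpoly_vars p \<subseteq> Y}"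
proof (unfold cpoly.subspace_def, safe)
  fix p q :: "'a cpoly" and v
  assume "cpoly_vars p \<subseteq> Y" "cpoly_vars q \<subseteq> Y" "v \<in> cpoly_vars (p + q)"
  then show "v \<in> Y"
    using keys_add[of p q] unfolding cpoly_vars_def by blast
next
  fix c v and p :: "'a cpoly"
  assume "cpoly_vars p \<subseteq> Y" "v \<in> cpoly_vars (cpoly_scale c p)"
  then show "v \<in> Y" using cpoly_varsI[of p] by (fastforce elim!: cpoly_varsE)
qed (auto simp: cpoly_vars_def in_keys_iff)

lemma cpoly_vars_mult: "cpoly_vars (p * q) \<subseteq> cpoly_vars p \<union> cpoly_vars q"
proof
  fix v assume "v \<in> cpoly_vars (p * q)"
  then obtain m where m: "m \<in> Poly_Mapping.keys (p * q)" "v \<in> Poly_Mapping.keys m"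
    by (auto simp: cpoly_vars_def)
  then obtain a b where "m = a + b" "a \<in> Poly_Mapping.keys p" "b \<in> Poly_Mapping.keys q"
    using keys_mult[of p q] by blast
  then show "v \<in> cpoly_vars p \<union> cpoly_vars q"
    using m(2) keys_add[of a b] by (auto simp: cpoly_vars_def)
qed

lemma cpoly_vars_power: "cpoly_vars (l ^ n) \<subseteq> cpoly_vars l"
proof (induction n)
  case (Suc n)
  then show ?case using cpoly_vars_mult[of l "l ^ n"] by auto
qed (simp add: cpoly_vars_def)

lemma cpoly_vars_empty_form:
  assumes "is_form d p" "0 < d" "cpoly_vars p = {}"
  shows "p = 0"
proof (rule poly_mapping_eqI)
  fix m show "Poly_Mapping.lookup p m = Poly_Mapping.lookup 0 m"
  proof (rule ccontr)
    assume "Poly_Mapping.lookup p m \<noteq> Poly_Mapping.lookup 0 m"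
    then have ne: "Poly_Mapping.lookup p m \<noteq> 0" by simp
    then have "Poly_Mapping.keys m = {}"
      using assms(3) cpoly_varsI[OF ne] by blast
    then have "mono_degree m = 0" by (simp add: mono_degree_def)
    then show False using is_formD[OF assms(1) ne] assms(2) by simp
  qed
qed

text \<open>The part of a polynomial that is supported on a given set of monomials.\<close>

definition monomial_part :: "('v \<Rightarrow>\<^sub>0 nat) set \<Rightarrow> 'v cpoly \<Rightarrow> 'v cpoly"
  where "monomial_part S p = Poly_Mapping.mapp (\<lambda>m c. if m \<in> S then c else 0) p"

lemma lookup_monomial_part [simp]:
  "Poly_Mapping.lookup (monomial_part S p) m = (if m \<in> S then Poly_Mapping.lookup p m else 0)"
  by (auto simp: monomial_part_def lookup_mapp "when_def" in_keys_iff)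

lemma monomial_part_0 [simp]: "monomial_part S 0 = 0"
  by (rule poly_mapping_eqI) simp

lemma monomial_part_add: "monomial_part S (p + q) = monomial_part S p + monomial_part S q"
  by (rule poly_mapping_eqI) (simp add: lookup_add)

lemma monomial_part_scale: "monomial_part S (cpoly_scale c p) = cpoly_scale c (monomial_part S p)"
  by (rule poly_mapping_eqI) simp

lemma monomial_part_sum: "monomial_part S (\<Sum>i\<in>I. p i) = (\<Sum>i\<in>I. monomial_part S (p i))"
  by (rule poly_mapping_eqI) (simp add: lookup_sum)

lemma monomial_part_degree_same: "is_form d p \<Longrightarrow> monomial_part {m. mono_degree m = d} p = p"
  by (rule poly_mapping_eqI) (auto dest: is_formD)

lemma monomial_part_degree_other:
  "is_form e p \<Longrightarrow> e \<noteq> d \<Longrightarrow> monomial_part {m. mono_degree m = d} p = 0"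
  by (rule poly_mapping_eqI) (auto dest: is_formD)

lemma monomial_part_vars_same:
  "cpoly_vars p \<subseteq> Y \<Longrightarrow> monomial_part {m. Poly_Mapping.keys m \<subseteq> Y} p = p"
  by (rule poly_mapping_eqI) (auto dest: cpoly_varsI)

text \<open>A constant would survive, whence the positive degree.\<close>

lemma monomial_part_vars_disjoint:
  assumes "is_form d p" "0 < d" "cpoly_vars p \<subseteq> Z" "Z \<inter> Y = {}"
  shows "monomial_part {m. Poly_Mapping.keys m \<subseteq> Y} p = 0"
proof (rule poly_mapping_eqI)
  fix m
  have "Poly_Mapping.lookup p m = 0" if sub: "Poly_Mapping.keys m \<subseteq> Y"
  proof (rule ccontr)
    assume ne: "Poly_Mapping.lookup p m \<noteq> 0"
    then have "Poly_Mapping.keys m \<subseteq> Z" using assms(3) cpoly_varsI[OF ne] by auto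
    then have "Poly_Mapping.keys m = {}" using sub assms(4) by blast
    then have "mono_degree m = 0" by (simp add: mono_degree_def)
    then show False using is_formD[OF assms(1) ne] assms(2) by simp
  qed
  then show "Poly_Mapping.lookup (monomial_part {m. Poly_Mapping.keys m \<subseteq> Y} p) m
      = Poly_Mapping.lookup 0 m" by simp
qed

section \<open>Partial derivatives\<close>

lemma lookup_pderiv:
  "Poly_Mapping.lookup (cpoly_pderiv v p) n =
    of_nat (Poly_Mapping.lookup n v + 1) * Poly_Mapping.lookup p (n + Poly_Mapping.single v 1)"
proof -
  let ?s = "Poly_Mapping.single v (1::nat)"
  let ?c = "of_nat (Poly_Mapping.lookup n v + 1) * Poly_Mapping.lookup p (n + ?s)"
  have shift: "of_nat (Poly_Mapping.lookup m v) * Poly_Mapping.lookup p m = 0 \<or> m = n + ?s"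
    if "m - ?s = n" for m
  proof (cases "v \<in> Poly_Mapping.keys m")
    case True
    then show ?thesis using monomial_split[OF True] that by simp
  next
    case False
    then show ?thesis by (simp add: in_keys_iff)
  qed
  have "Poly_Mapping.lookup (cpoly_pderiv v p) n =
      (\<Sum>m\<in>Poly_Mapping.keys p. if m = n + ?s then ?c else 0)"
    unfolding cpoly_pderiv_def lookup_sum
    using shift by (intro sum.cong refl) (auto simp: lookup_single "when_def" lookup_add)
  also have "\<dots> = ?c"
    by (simp add: in_keys_iff)
  finally show ?thesis .
qed

lemma pderiv_0 [simp]: "cpoly_pderiv v 0 = 0"
  by (simp add: cpoly_pderiv_def)

lemma pderiv_add: "cpoly_pderiv v (p + q) = cpoly_pderiv v p + cpoly_pderiv v q"
  by (rule poly_mapping_eqI) (simp add: lookup_pderiv lookup_add algebra_simps)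

lemma pderiv_scale: "cpoly_pderiv v (cpoly_scale c p) = cpoly_scale c (cpoly_pderiv v p)"
  by (rule poly_mapping_eqI) (simp add: lookup_pderiv)

lemma pderiv_sum: "cpoly_pderiv v (\<Sum>i\<in>I. p i) = (\<Sum>i\<in>I. cpoly_pderiv v (p i))"
  by (rule poly_mapping_eqI) (simp add: lookup_pderiv lookup_sum sum_distrib_left)

lemma pderiv_commute: "cpoly_pderiv v (cpoly_pderiv w p) = cpoly_pderiv w (cpoly_pderiv v p)"
  by (rule poly_mapping_eqI)
    (auto simp: lookup_pderiv lookup_add lookup_single "when_def" ac_simps)

lemma pderiv_eq_0: "v \<notin> cpoly_vars p \<Longrightarrow> cpoly_pderiv v p = 0"
proof (rule poly_mapping_eqI)
  fix n assume v: "v \<notin> cpoly_vars p"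
  have "v \<in> Poly_Mapping.keys (n + Poly_Mapping.single v (1::nat))"
    by (simp add: in_keys_iff lookup_add)
  then have "Poly_Mapping.lookup p (n + Poly_Mapping.single v 1) = 0"
    using v cpoly_varsI[of p "n + Poly_Mapping.single v 1" v] by blast
  then show "Poly_Mapping.lookup (cpoly_pderiv v p) n = Poly_Mapping.lookup 0 n"
    by (simp add: lookup_pderiv)
qed

lemma cpoly_vars_pderiv: "cpoly_vars (cpoly_pderiv v p) \<subseteq> cpoly_vars p"
proof
  fix w assume "w \<in> cpoly_vars (cpoly_pderiv v p)"
  then obtain n where n: "Poly_Mapping.lookup (cpoly_pderiv v p) n \<noteq> 0" "w \<in> Poly_Mapping.keys n"
    by (rule cpoly_varsE)
  then have "Poly_Mapping.lookup p (n + Poly_Mapping.single v 1) \<noteq> 0"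
    by (auto simp: lookup_pderiv)
  moreover have "w \<in> Poly_Mapping.keys (n + Poly_Mapping.single v 1)"
    using n(2) by (simp add: in_keys_iff lookup_add)
  ultimately show "w \<in> cpoly_vars p" by (rule cpoly_varsI)
qed

text \<open>
  The derivative of a constant is \<open>0\<close>, which is a form of every degree; hence the truncated
  subtraction is harmless.
\<close>

lemma is_form_pderiv: "is_form d p \<Longrightarrow> is_form (d - 1) (cpoly_pderiv v p)"
proof (rule is_formI)
  fix n assume p: "is_form d p" and "Poly_Mapping.lookup (cpoly_pderiv v p) n \<noteq> 0"
  then have "Poly_Mapping.lookup p (n + Poly_Mapping.single v 1) \<noteq> 0"
    by (auto simp: lookup_pderiv)
  from is_formD[OF p this] show "mono_degree n = d - 1"
    by (simp add: mono_degree_add)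
qed

lemma cpoly_sum_monomials:
  "p = (\<Sum>m\<in>Poly_Mapping.keys p. Poly_Mapping.single m (Poly_Mapping.lookup p m))"
  by (rule poly_mapping_eqI) (simp add: lookup_sum lookup_single "when_def" in_keys_iff)

lemma pderiv_single:
  "cpoly_pderiv v (Poly_Mapping.single m c) =
    Poly_Mapping.single (m - Poly_Mapping.single v 1) (of_nat (Poly_Mapping.lookup m v) * c)"
  by (cases "c = 0") (simp_all add: cpoly_pderiv_def)

lemma pderiv_mult_single:
  "cpoly_pderiv v (Poly_Mapping.single m c * Poly_Mapping.single n e) =
    cpoly_pderiv v (Poly_Mapping.single m c) * Poly_Mapping.single n e +
    Poly_Mapping.single m c * cpoly_pderiv v (Poly_Mapping.single n e)"
proof -
  let ?s = "Poly_Mapping.single v (1::nat)"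
  have shift: "(x - ?s) + y = (x + y) - ?s" if "Poly_Mapping.lookup x v \<noteq> 0" for x y :: "'a \<Rightarrow>\<^sub>0 nat"
    using that
    by (intro poly_mapping_eqI) (auto simp: lookup_add lookup_minus lookup_single "when_def")
  have a: "cpoly_pderiv v (Poly_Mapping.single m c) * Poly_Mapping.single n e =
      Poly_Mapping.single (m + n - ?s) (of_nat (Poly_Mapping.lookup m v) * c * e)"
    using shift[of m n]
    by (cases "Poly_Mapping.lookup m v = 0") (auto simp: pderiv_single mult_single)
  have b: "Poly_Mapping.single m c * cpoly_pderiv v (Poly_Mapping.single n e) =
      Poly_Mapping.single (m + n - ?s) (of_nat (Poly_Mapping.lookup n v) * c * e)"
    using shift[of n m]
    by (cases "Poly_Mapping.lookup n v = 0") (auto simp: pderiv_single mult_single ac_simps)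
  show ?thesis
    unfolding a b by (simp add: mult_single pderiv_single lookup_add single_add[symmetric] algebra_simps)
qed

lemma pderiv_mult: "cpoly_pderiv v (p * q) = cpoly_pderiv v p * q + p * cpoly_pderiv v q"
proof -
  define P where "P m = Poly_Mapping.single m (Poly_Mapping.lookup p m)" for m
  define Q where "Q m = Poly_Mapping.single m (Poly_Mapping.lookup q m)" for m
  have p: "p = (\<Sum>m\<in>Poly_Mapping.keys p. P m)" and q: "q = (\<Sum>m\<in>Poly_Mapping.keys q. Q m)"
    unfolding P_def Q_def by (rule cpoly_sum_monomials)+
  have "cpoly_pderiv v ((\<Sum>m\<in>A. P m) * (\<Sum>n\<in>B. Q n)) =
      cpoly_pderiv v (\<Sum>m\<in>A. P m) * (\<Sum>n\<in>B. Q n) +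
      (\<Sum>m\<in>A. P m) * cpoly_pderiv v (\<Sum>n\<in>B. Q n)" for A B
  proof -
    have "cpoly_pderiv v (P m * Q n) = cpoly_pderiv v (P m) * Q n + P m * cpoly_pderiv v (Q n)" for m n
      unfolding P_def Q_def by (rule pderiv_mult_single)
    then show ?thesis
      by (simp add: sum_product pderiv_sum sum.distrib)
  qed
  then show ?thesis using p q by metis
qed

lemma pderiv_linear_form:
  assumes "is_form 1 l"
  shows "cpoly_pderiv v l = cpoly_scale (Poly_Mapping.lookup l (Poly_Mapping.single v 1)) 1"
proof (rule poly_mapping_eqI)
  fix n
  have "n = 0" if "Poly_Mapping.lookup l (n + Poly_Mapping.single v 1) \<noteq> 0"
    using is_formD[OF assms that] by (simp add: mono_degree_add mono_degree_eq_0_iff)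
  then show "Poly_Mapping.lookup (cpoly_pderiv v l) n =
      Poly_Mapping.lookup (cpoly_scale (Poly_Mapping.lookup l (Poly_Mapping.single v 1)) 1) n"
    by (auto simp: lookup_pderiv lookup_one "when_def")
qed

lemma pderiv_power_linear_form:
  assumes "is_form 1 l"
  shows "cpoly_pderiv v (l ^ n) =
    cpoly_scale (of_nat n * Poly_Mapping.lookup l (Poly_Mapping.single v 1)) (l ^ (n - 1))"
proof (induction n)
  case 0
  show ?case by (rule poly_mapping_eqI) (simp add: lookup_pderiv lookup_one mono_degree_eq_0_iff[symmetric] mono_degree_add)
next
  case (Suc n)
  let ?c = "Poly_Mapping.lookup l (Poly_Mapping.single v 1)"
  have "l * cpoly_pderiv v (l ^ n) = cpoly_scale (of_nat n * ?c) (l * l ^ (n - 1))"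
    using Suc by (simp add: cpoly_scale_def mult.left_commute)
  also have "\<dots> = cpoly_scale (of_nat n * ?c) (l ^ n)"
    by (cases n) simp_all
  finally have "l * cpoly_pderiv v (l ^ n) = cpoly_scale (of_nat n * ?c) (l ^ n)" .
  then show ?case
    by (simp add: pderiv_mult pderiv_linear_form[OF assms] cpoly_scale_mult_left
        cpoly.scale_left_distrib distrib_right)
qed

lemma fold_pderiv_0 [simp]: "fold cpoly_pderiv vs 0 = 0"
  by (induction vs) simp_all

lemma fold_pderiv_scale:
  "fold cpoly_pderiv vs (cpoly_scale c p) = cpoly_scale c (fold cpoly_pderiv vs p)"
  by (induction vs arbitrary: p) (simp_all add: pderiv_scale)

lemma fold_pderiv_sum:
  "fold cpoly_pderiv vs (\<Sum>i\<in>I. p i) = (\<Sum>i\<in>I. fold cpoly_pderiv vs (p i))"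
  by (induction vs arbitrary: p) (simp_all add: pderiv_sum)

lemma is_form_fold_pderiv: "is_form d p \<Longrightarrow> is_form (d - length vs) (fold cpoly_pderiv vs p)"
proof (induction vs arbitrary: p d)
  case (Cons v vs)
  then show ?case using Cons.IH[OF is_form_pderiv[OF Cons.prems]] by simp
qed simp

lemma cpoly_vars_fold_pderiv: "cpoly_vars (fold cpoly_pderiv vs p) \<subseteq> cpoly_vars p"
proof (induction vs arbitrary: p)
  case (Cons v vs)
  then show ?case using Cons.IH[of "cpoly_pderiv v p"] cpoly_vars_pderiv[of v p] by auto
qed simp

lemma fold_pderiv_eq_0:
  assumes "\<not> set vs \<subseteq> cpoly_vars p"
  shows "fold cpoly_pderiv vs p = 0"
  using assms
proof (induction vs arbitrary: p)
  case (Cons v vs)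
  show ?case
  proof (cases "v \<in> cpoly_vars p")
    case True
    then have "\<not> set vs \<subseteq> cpoly_vars (cpoly_pderiv v p)"
      using Cons.prems cpoly_vars_pderiv[of v p] by auto
    then show ?thesis using Cons.IH by simp
  next
    case False
    then show ?thesis by (simp add: pderiv_eq_0)
  qed
qed simp

lemma fold_pderiv_commute:
  "cpoly_pderiv v (fold cpoly_pderiv vs p) = fold cpoly_pderiv vs (cpoly_pderiv v p)"
  by (induction vs arbitrary: p) (simp_all add: pderiv_commute)

lemma fold_pderiv_power_linear_form:
  assumes "is_form 1 l"
  shows "\<exists>c. fold cpoly_pderiv vs (l ^ n) = cpoly_scale c (l ^ (n - length vs))"
proof (induction vs arbitrary: n)
  case Nil
  show ?case by (rule exI[of _ 1]) simp
next
  case (Cons v vs)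
  obtain c where c: "fold cpoly_pderiv vs (l ^ (n - 1)) = cpoly_scale c (l ^ (n - 1 - length vs))"
    using Cons by blast
  have "fold cpoly_pderiv (v # vs) (l ^ n) =
      cpoly_scale (of_nat n * Poly_Mapping.lookup l (Poly_Mapping.single v 1) * c)
        (l ^ (n - length (v # vs)))"
    by (simp only: fold.simps o_apply pderiv_power_linear_form[OF assms] fold_pderiv_scale c)
      (simp add: cpoly.scale_scale)
  then show ?case by blast
qed

section \<open>The graded pieces of the derivative space\<close>

lemma fold_pderiv_in_Derivs: "fold cpoly_pderiv vs F \<in> Derivs F"
  unfolding Derivs_def by (rule cpoly.span_base) blast

text \<open>
  A derivative of order \<open>n\<close> is a form of degree \<open>d - n\<close> with truncated subtraction, and as
  \<open>a > 0\<close>, this degree is \<open>a\<close> only for \<open>n = d - a\<close>.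
\<close>

lemma Derivs_graded_eq_span:
  assumes F: "is_form d F" and a: "0 < a" "a \<le> d"
  shows "Derivs_graded F a = cpoly.span {fold cpoly_pderiv vs F | vs. length vs = d - a}"
    (is "_ = cpoly.span ?S")
proof
  show "Derivs_graded F a \<subseteq> cpoly.span ?S"
  proof
    fix G assume "G \<in> Derivs_graded F a"
    then have G: "G \<in> Derivs F" "is_form a G" by (auto simp: Derivs_graded_def)
    \<comment> \<open>The projection to degree \<open>a\<close> fixes \<open>G\<close> and kills the derivatives of other orders.\<close>
    let ?H = "monomial_part {m. mono_degree m = a}"
    have "?H G \<in> cpoly.span ?S"
      using G(1) unfolding Derivs_def
    proof (induction rule: cpoly.span_induct_alt)
      case (step c x y)
      then obtain vs where x: "x = fold cpoly_pderiv vs F" by auto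
      have form: "is_form (d - length vs) x"
        unfolding x by (rule is_form_fold_pderiv[OF F])
      have "?H x \<in> cpoly.span ?S"
      proof (cases "length vs = d - a")
        case True
        then have "?H x = x" using form a by (simp add: monomial_part_degree_same)
        moreover have "x \<in> ?S" using True x by blast
        ultimately show ?thesis by (simp add: cpoly.span_base)
      next
        case False
        then have "d - length vs \<noteq> a" using a by linarith
        from monomial_part_degree_other[OF form this] show ?thesis by (simp add: cpoly.span_zero)
      qed
      then show ?case using step
        by (simp add: monomial_part_add monomial_part_scale cpoly.span_add cpoly.span_scale)
    qed (simp add: cpoly.span_zero)
    then show "G \<in> cpoly.span ?S" using monomial_part_degree_same[OF G(2)] by simp
  qed
  have "cpoly.span ?S \<subseteq> Derivs F"
    unfolding Derivs_def by (rule cpoly.span_mono) blast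
  moreover have "cpoly.span ?S \<subseteq> {p. is_form a p}"
  proof (rule cpoly.span_minimal[OF _ subspace_is_form])
    show "?S \<subseteq> {p. is_form a p}"
    proof clarify
      fix vs :: "'a list" assume "length vs = d - a"
      then show "is_form a (fold cpoly_pderiv vs F)"
        using is_form_fold_pderiv[OF F, of vs] a by simp
    qed
  qed
  ultimately show "cpoly.span ?S \<subseteq> Derivs_graded F a"
    by (auto simp: Derivs_graded_def)
qed

text \<open>
  The lower bound for the Waring rank: every derivative of order \<open>d - a\<close> of a \<open>d\<close>-th power
  of a linear form is a multiple of its \<open>a\<close>-th power.
\<close>

lemma Derivs_graded_subset_span_powers:
  assumes l: "\<And>j. j \<in> J \<Longrightarrow> is_form 1 (l j)" and F: "F = (\<Sum>j\<in>J. l j ^ d)"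
    and a: "0 < a" "a \<le> d"
  shows "Derivs_graded F a \<subseteq> cpoly.span ((\<lambda>j. l j ^ a) ` J)"
proof -
  have "is_form d F"
    unfolding F by (intro is_form_sum is_form_power l)
  moreover have "fold cpoly_pderiv vs F \<in> cpoly.span ((\<lambda>j. l j ^ a) ` J)"
    if "length vs = d - a" for vs
    unfolding F fold_pderiv_sum
  proof (rule cpoly.span_sum)
    fix j assume j: "j \<in> J"
    obtain c where "fold cpoly_pderiv vs (l j ^ d) = cpoly_scale c (l j ^ (d - length vs))"
      using fold_pderiv_power_linear_form[OF l[OF j]] by blast
    then show "fold cpoly_pderiv vs (l j ^ d) \<in> cpoly.span ((\<lambda>j. l j ^ a) ` J)"
      using j a that by (simp add: cpoly.span_base cpoly.span_scale)
  qed
  ultimately show ?thesis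
    using a by (simp only: Derivs_graded_eq_span) (intro cpoly.span_minimal cpoly.subspace_span; blast)
qed

lemma cpoly_vars_Derivs:
  assumes "G \<in> Derivs F"
  shows "cpoly_vars G \<subseteq> cpoly_vars F"
proof -
  have "Derivs F \<subseteq> {p. cpoly_vars p \<subseteq> cpoly_vars F}"
    unfolding Derivs_def
  proof (rule cpoly.span_minimal[OF _ subspace_cpoly_vars], clarify)
    fix vs v assume "v \<in> cpoly_vars (fold cpoly_pderiv vs F)"
    then show "v \<in> cpoly_vars F" using cpoly_vars_fold_pderiv[of vs F] by blast
  qed
  then show ?thesis using assms by blast
qed

lemma pderiv_pderiv_Derivs_eq_0:
  assumes "cpoly_pderiv v (cpoly_pderiv w F) = 0" "G \<in> Derivs F"
  shows "cpoly_pderiv v (cpoly_pderiv w G) = 0"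
  using assms(2) unfolding Derivs_def
proof (induction rule: cpoly.span_induct_alt)
  case (step c x y)
  then show ?case
    using assms(1) by (auto simp: pderiv_add pderiv_scale fold_pderiv_commute)
qed simp

section \<open>Every form is a sum of powers of linear forms\<close>

text \<open>The iterated forward difference of \<open>f\<close> with steps \<open>xs\<close>.\<close>

primrec iterated_diff :: "'a::ab_group_add list \<Rightarrow> ('a \<Rightarrow> 'b::ab_group_add) \<Rightarrow> 'a \<Rightarrow> 'b" where
  "iterated_diff [] f y = f y"
| "iterated_diff (x # xs) f y = iterated_diff xs (\<lambda>y. f (y + x) - f y) y"

lemma iterated_diff_sum:
  fixes c :: "'i \<Rightarrow> 'b::comm_ring_1"
  shows "iterated_diff xs (\<lambda>y. \<Sum>i\<in>I. c i * f i y) y = (\<Sum>i\<in>I. c i * iterated_diff xs (f i) y)"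
  by (induction xs arbitrary: f)
    (simp_all add: sum_subtractf[symmetric] right_diff_distrib[symmetric])

text \<open>
  Polarization: each difference lowers the degree by one, so that \<open>d\<close> differences of the
  \<open>d\<close>-th power leave the product of the steps, up to the factor \<open>d!\<close>.
\<close>

lemma iterated_diff_power:
  fixes y :: "'a::comm_ring_1"
  assumes "d \<le> length xs"
  shows "iterated_diff xs (\<lambda>y. y ^ d) y = (if d = length xs then of_nat (fact d) * prod_list xs else 0)"
  using assms
proof (induction xs arbitrary: d)
  case (Cons x xs)
  define c where "c i = of_nat (d choose i) * x ^ (d - i)" for i
  have "(\<lambda>y. (y + x) ^ d - y ^ d) = (\<lambda>y. \<Sum>i<d. c i * y ^ i)"
  proof
    fix y
    have "(y + x) ^ d = (\<Sum>i<d. of_nat (d choose i) * y ^ i * x ^ (d - i)) + y ^ d"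
      by (simp add: binomial_ring lessThan_Suc_atMost[symmetric])
    then show "(y + x) ^ d - y ^ d = (\<Sum>i<d. c i * y ^ i)"
      by (simp add: c_def ac_simps)
  qed
  then have "iterated_diff (x # xs) (\<lambda>y. y ^ d) y =
      (\<Sum>i<d. c i * iterated_diff xs (\<lambda>y. y ^ i) y)"
    by (simp add: iterated_diff_sum)
  also have "\<dots> = (\<Sum>i<d. if i = length xs then c i * (of_nat (fact i) * prod_list xs) else 0)"
    using Cons by (intro sum.cong refl) auto
  also have "\<dots> = (if d = Suc (length xs) then c (length xs) * (of_nat (fact (length xs)) * prod_list xs) else 0)"
    using Cons.prems by auto
  also have "\<dots> = (if d = length (x # xs) then of_nat (fact d) * prod_list (x # xs) else 0)"
    by (auto simp: c_def algebra_simps)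
  finally show ?case .
qed simp

text \<open>The space spanned by the \<open>d\<close>-th powers of linear forms.\<close>

abbreviation power_span :: "nat \<Rightarrow> 'v cpoly set"
  where "power_span d \<equiv> cpoly.span {l ^ d | l. is_form 1 l}"

lemma iterated_diff_in_subspace:
  assumes "cpoly.subspace S" "\<And>y. is_form 1 y \<Longrightarrow> f y \<in> S" "\<forall>x\<in>set xs. is_form 1 x" "is_form 1 y"
  shows "iterated_diff xs f y \<in> S"
  using assms
proof (induction xs arbitrary: f)
  case (Cons x xs)
  have "f (y + x) - f y \<in> S" if "is_form 1 y" for y
    using that Cons.prems by (intro cpoly.subspace_diff) (auto intro: is_form_add)
  then show ?case using Cons by simp
qed simp

lemma monomial_eq_prod_linear_forms:
  "\<exists>xs :: 'v cpoly list. length xs = mono_degree m \<and> (\<forall>x\<in>set xs. is_form 1 x) \<and>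
    Poly_Mapping.single m 1 = prod_list xs"
proof (induction "mono_degree m" arbitrary: m)
  case 0
  then have "m = 0" by (simp add: mono_degree_eq_0_iff)
  then show ?case by (intro exI[of _ "[]"]) simp
next
  case (Suc n)
  then have "m \<noteq> 0" by auto
  then obtain v where v: "v \<in> Poly_Mapping.keys m" by (auto simp del: keys_eq_empty simp flip: keys_eq_empty)
  let ?s = "Poly_Mapping.single v (1::nat)"
  note split = monomial_split[OF v]
  have "mono_degree m = mono_degree (m - ?s) + 1"
    by (subst split) (simp add: mono_degree_add)
  with Suc obtain xs :: "'v cpoly list" where xs: "length xs = mono_degree (m - ?s)"
    "\<forall>x\<in>set xs. is_form 1 x" "Poly_Mapping.single (m - ?s) 1 = prod_list xs"
    by (metis add_right_cancel Suc_eq_plus1)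
  have "Poly_Mapping.single m (1::complex) =
      Poly_Mapping.single ?s 1 * Poly_Mapping.single (m - ?s) 1"
    using split by (simp add: mult_single add.commute)
  then show ?case
    using xs \<open>mono_degree m = _\<close>
    by (intro exI[of _ "Poly_Mapping.single ?s 1 # xs"]) (simp add: is_form_def)
qed

lemma form_in_power_span:
  assumes "is_form d F"
  shows "F \<in> power_span d"
proof -
  have "Poly_Mapping.single m (1::complex) \<in> power_span d" if m: "mono_degree m = d" for m :: "'a \<Rightarrow>\<^sub>0 nat"
  proof -
    obtain xs :: "'a cpoly list" where xs: "length xs = d" "\<forall>x\<in>set xs. is_form 1 x"
      "Poly_Mapping.single m 1 = prod_list xs"
      using monomial_eq_prod_linear_forms[of m] m by blast
    have "iterated_diff xs (\<lambda>y. y ^ d) 0 \<in> power_span d"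
      using xs(2) by (intro iterated_diff_in_subspace) (auto intro: cpoly.span_base)
    then have "of_nat (fact d) * Poly_Mapping.single m 1 \<in> power_span d"
      by (simp add: iterated_diff_power xs)
    also have "of_nat (fact d) * Poly_Mapping.single m 1 = cpoly_scale (fact d) (Poly_Mapping.single m 1)"
      unfolding cpoly_scale_def by (metis of_nat_fact single_of_nat)
    finally have "cpoly_scale (fact d) (Poly_Mapping.single m 1) \<in> power_span d" .
    from cpoly.span_scale[OF this, of "1 / fact d"] show ?thesis by simp
  qed
  then have "cpoly_scale (Poly_Mapping.lookup F m) (Poly_Mapping.single m 1) \<in> power_span d"
    if "m \<in> Poly_Mapping.keys F" for m
    using assms that by (intro cpoly.span_scale) (simp add: is_form_def)
  then have "(\<Sum>m\<in>Poly_Mapping.keys F. Poly_Mapping.single m (Poly_Mapping.lookup F m)) \<in> power_span d"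
    by (intro cpoly.span_sum) (simp add: cpoly_scale_def mult_single)
  then show ?thesis using cpoly_sum_monomials[of F] by simp
qed

lemma complex_root_exists:
  assumes "0 < d"
  shows "\<exists>w :: complex. w ^ d = c"
proof
  show "(rcis (root d (cmod c)) (Arg c / of_nat d)) ^ d = c"
    using assms by (simp add: DeMoivre2 rcis_cmod_Arg)
qed

lemma form_is_sum_of_powers:
  assumes "is_form d F" "0 < d"
  shows "\<exists>(J :: 'v cpoly set) l. finite J \<and> (\<forall>j\<in>J. is_form 1 (l j)) \<and> (F :: 'v cpoly) = (\<Sum>j\<in>J. l j ^ d)"
proof -
  obtain T u where T: "finite T" "T \<subseteq> {l ^ d | l. is_form 1 l}" "F = (\<Sum>q\<in>T. cpoly_scale (u q) q)"
    using form_in_power_span[OF assms(1)] unfolding cpoly.span_explicit by blast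
  have "\<exists>l. is_form 1 l \<and> l ^ d = cpoly_scale (u q) q" if q: "q \<in> T" for q
  proof -
    obtain l where l: "is_form 1 l" "q = l ^ d" using T(2) q by blast
    obtain w where "w ^ d = u q" using complex_root_exists[OF assms(2)] by blast
    then show ?thesis using l
      by (intro exI[of _ "cpoly_scale w l"]) (simp add: cpoly_scale_power is_form_scale)
  qed
  then obtain l where l: "\<And>q. q \<in> T \<Longrightarrow> is_form 1 (l q) \<and> l q ^ d = cpoly_scale (u q) q"
    by metis
  then have "F = (\<Sum>q\<in>T. l q ^ d)" using T(3) by simp
  then show ?thesis using T(1) l by blast
qed

section \<open>Waring rank\<close>

text \<open>
  The Waring rank is defined by families indexed by an initial segment; any finite index set will
  do.
\<close>

lemma reindex_sum_of_powers:
  assumes "finite J" "\<forall>j\<in>J. is_form 1 (l j)"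
  shows "\<exists>l' :: nat \<Rightarrow> 'v cpoly. (\<forall>j\<in>{1..card J}. is_form 1 (l' j)) \<and>
    (\<Sum>j\<in>J. l j ^ d) = (\<Sum>j\<in>{1..card J}. l' j ^ d)"
proof -
  obtain h where h: "bij_betw h {1..card J} J"
    using ex_bij_betw_nat_finite_1[OF assms(1)] by blast
  show ?thesis
    using assms(2) bij_betwE[OF h] sum.reindex_bij_betw[OF h, of "\<lambda>j. l j ^ d"]
    by (intro exI[of _ "l \<circ> h"]) auto
qed

lemma waring_rank_le:
  assumes "finite J" "\<forall>j\<in>J. is_form 1 (l j)" "F = (\<Sum>j\<in>J. l j ^ d)"
  shows "waring_rank d F \<le> card J"
  unfolding waring_rank_def assms(3)
  using reindex_sum_of_powers[OF assms(1,2), of d] by (intro Least_le) auto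

lemma waring_rank_attained:
  assumes "is_form d F" "0 < d"
  obtains l :: "nat \<Rightarrow> 'v cpoly"
  where "\<forall>j\<in>{1..waring_rank d F}. is_form 1 (l j)" "F = (\<Sum>j\<in>{1..waring_rank d F}. l j ^ d)"
proof -
  let ?P = "\<lambda>r. \<exists>l :: nat \<Rightarrow> 'v cpoly. (\<forall>j\<in>{1..r}. is_form 1 (l j)) \<and> F = (\<Sum>j\<in>{1..r}. l j ^ d)"
  obtain J :: "'v cpoly set" and l
    where "finite J" "\<forall>j\<in>J. is_form 1 (l j)" "F = (\<Sum>j\<in>J. l j ^ d)"
    using form_is_sum_of_powers[OF assms] by blast
  then have "?P (card J)" using reindex_sum_of_powers by blast
  then have "?P (waring_rank d F)" unfolding waring_rank_def by (rule LeastI)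
  then show ?thesis using that by blast
qed

lemma dim_Derivs_graded_le_waring_rank:
  assumes "is_form d F" "0 < a" "a \<le> d"
  shows "cpoly.dim (Derivs_graded F a) \<le> waring_rank d F"
proof -
  have "0 < d" using assms by simp
  then obtain l :: "nat \<Rightarrow> 'a cpoly"
    where l: "\<forall>j\<in>{1..waring_rank d F}. is_form 1 (l j)" "F = (\<Sum>j\<in>{1..waring_rank d F}. l j ^ d)"
    using waring_rank_attained[OF assms(1)] by metis
  let ?S = "(\<lambda>j. l j ^ a) ` {1..waring_rank d F}"
  have "Derivs_graded F a \<subseteq> cpoly.span ?S"
    using l by (intro Derivs_graded_subset_span_powers[OF _ l(2) assms(2,3)]) auto
  then have "cpoly.dim (Derivs_graded F a) \<le> card ?S"
    by (intro cpoly.dim_le_card) auto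
  also have "\<dots> \<le> waring_rank d F"
    using card_image_le[of "{1..waring_rank d F}" "\<lambda>j. l j ^ a"] by simp
  finally show ?thesis .
qed

lemma waring_rank_sum_le:
  fixes Fs :: "'i \<Rightarrow> 'v cpoly"
  assumes "finite I" "\<And>i. i \<in> I \<Longrightarrow> is_form d (Fs i)" "0 < d"
  shows "waring_rank d (\<Sum>i\<in>I. Fs i) \<le> (\<Sum>i\<in>I. waring_rank d (Fs i))"
proof -
  have "\<exists>l :: nat \<Rightarrow> 'v cpoly. (\<forall>j\<in>{1..waring_rank d (Fs i)}. is_form 1 (l j)) \<and>
      Fs i = (\<Sum>j\<in>{1..waring_rank d (Fs i)}. l j ^ d)" if "i \<in> I" for i
    using waring_rank_attained[OF assms(2)[OF that] assms(3)] by metis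
  then obtain l :: "'i \<Rightarrow> nat \<Rightarrow> 'v cpoly"
    where l: "\<And>i. i \<in> I \<Longrightarrow> (\<forall>j\<in>{1..waring_rank d (Fs i)}. is_form 1 (l i j)) \<and>
      Fs i = (\<Sum>j\<in>{1..waring_rank d (Fs i)}. l i j ^ d)"
    by metis
  let ?J = "SIGMA i:I. {1..waring_rank d (Fs i)}"
  have "(\<Sum>i\<in>I. Fs i) = (\<Sum>i\<in>I. \<Sum>j\<in>{1..waring_rank d (Fs i)}. l i j ^ d)"
    using l by (intro sum.cong) auto
  also have "\<dots> = (\<Sum>z\<in>?J. (case z of (i, j) \<Rightarrow> l i j) ^ d)"
    using assms(1) by (subst sum.Sigma) (auto intro: sum.cong)
  finally have "waring_rank d (\<Sum>i\<in>I. Fs i) \<le> card ?J"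
    using assms(1) l by (intro waring_rank_le) auto
  then show ?thesis using assms(1) by simp
qed

section \<open>Linear independence\<close>

text \<open>
  A family of \<open>dim V\<close> elements whose span contains \<open>V\<close> is a basis of \<open>V\<close>; in particular its
  members lie in \<open>V\<close> and are not zero.
\<close>

lemma generators_of_length_dim:
  assumes J: "finite J" "card J = cpoly.dim V" and V: "cpoly.subspace V"
    and sub: "V \<subseteq> cpoly.span (f ` J)" and j: "j \<in> J"
  shows "f j \<in> V" "f j \<noteq> 0"
proof -
  obtain B where B: "B \<subseteq> V" "cpoly.independent B" "V \<subseteq> cpoly.span B" "card B = cpoly.dim V"
    using cpoly.basis_exists by blast
  have le: "finite C \<and> card C \<le> card J" if "cpoly.independent C" "C \<subseteq> cpoly.span (f ` J)" for C
    using cpoly.independent_span_bound[OF _ that] J(1) card_image_le[OF J(1), of f] by fastforce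
  have finB: "finite B" using le[OF B(2)] B(1) sub by blast
  show "f j \<in> V"
  proof (rule ccontr)
    assume "f j \<notin> V"
    then have notin: "f j \<notin> cpoly.span B"
      using cpoly.span_minimal[OF B(1) V] by blast
    then have "cpoly.independent (insert (f j) B)"
      using B(2) by (rule cpoly.independent_insertI)
    moreover have "insert (f j) B \<subseteq> cpoly.span (f ` J)"
      using B(1) sub j by (auto intro: cpoly.span_base)
    ultimately have "card (insert (f j) B) \<le> card J" using le by blast
    moreover have "f j \<notin> B" using notin cpoly.span_base by blast
    ultimately show False using finB B(4) J(2) by simp
  qed
  show "f j \<noteq> 0"
  proof
    assume 0: "f j = 0"
    have "cpoly.span (f ` J) = cpoly.span (f ` (J - {j}))"
      using 0 j by (metis cpoly.span_insert_0 image_insert insert_Diff)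
    then have "V \<subseteq> cpoly.span (f ` (J - {j}))" using sub by simp
    then have "cpoly.dim V \<le> card (f ` (J - {j}))"
      using J(1) by (intro cpoly.dim_le_card) auto
    also have "\<dots> \<le> card (J - {j})" using J(1) by (intro card_image_le) auto
    also have "\<dots> < card J" using J(1) j by (meson card_Diff1_less)
    finally show False using J(2) by simp
  qed
qed

text \<open>Forms of positive degree in disjoint sets of variables span independent spaces.\<close>

lemma independent_Union_disjoint_vars:
  assumes I: "finite I" and disj: "disjoint_family_on X I" and a: "0 < a"
    and B: "\<And>i. i \<in> I \<Longrightarrow> finite (B i)" "\<And>i. i \<in> I \<Longrightarrow> cpoly.independent (B i)"
      "\<And>i b. i \<in> I \<Longrightarrow> b \<in> B i \<Longrightarrow> is_form a b"
      "\<And>i b. i \<in> I \<Longrightarrow> b \<in> B i \<Longrightarrow> cpoly_vars b \<subseteq> X i"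
  shows "cpoly.independent (\<Union>i\<in>I. B i)" "card (\<Union>i\<in>I. B i) = (\<Sum>i\<in>I. card (B i))"
proof -
  \<comment> \<open>The restriction to the monomials in \<open>X i\<close> isolates the part of a relation in \<open>B i\<close>.\<close>
  let ?R = "\<lambda>i. monomial_part {m. Poly_Mapping.keys m \<subseteq> X i}"
  have same: "?R i b = b" if "i \<in> I" "b \<in> B i" for i b
    using B(4)[OF that] by (rule monomial_part_vars_same)
  have other: "?R i b = 0" if "i \<in> I" "i' \<in> I" "i \<noteq> i'" "b \<in> B i'" for i i' b
    using B(3,4)[OF that(2,4)] a disjoint_family_onD[OF disj that(2,1)] that(3)
    by (intro monomial_part_vars_disjoint) auto
  have nz: "0 \<notin> B i" if "i \<in> I" for i
    using B(2)[OF that] cpoly.dependent_zero by blast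
  have disjB: "B i \<inter> B i' = {}" if "i \<in> I" "i' \<in> I" "i \<noteq> i'" for i i'
    using same other nz that by (metis disjoint_iff)
  show "card (\<Union>i\<in>I. B i) = (\<Sum>i\<in>I. card (B i))"
    using I B(1) disjB by (intro card_UN_disjoint) auto
  show "cpoly.independent (\<Union>i\<in>I. B i)"
  proof (rule cpoly.independent_if_scalars_zero)
    fix u x assume sum0: "(\<Sum>b\<in>(\<Union>i\<in>I. B i). cpoly_scale (u b) b) = 0" and "x \<in> (\<Union>i\<in>I. B i)"
    then obtain i where i: "i \<in> I" "x \<in> B i" by blast
    have "0 = ?R i (\<Sum>b\<in>(\<Union>i\<in>I. B i). cpoly_scale (u b) b)"
      by (simp add: sum0)
    also have "\<dots> = (\<Sum>b\<in>(\<Union>i\<in>I. B i). cpoly_scale (u b) (?R i b))"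
      by (simp add: monomial_part_sum monomial_part_scale)
    also have "\<dots> = (\<Sum>b\<in>B i. cpoly_scale (u b) b)"
    proof (rule sum.mono_neutral_cong_right)
      show "\<forall>b\<in>(\<Union>i\<in>I. B i) - B i. cpoly_scale (u b) (?R i b) = 0"
        using other[OF i(1)] by fastforce
    qed (use I B(1) i(1) same[OF i(1)] in auto)
    finally have "(\<Sum>b\<in>B i. cpoly_scale (u b) b) = 0" by simp
    then show "u x = 0"
      using B(1,2)[OF i(1)] i(2) unfolding cpoly.independent_explicit_finite_subsets by blast
  qed (use I B(1) in auto)
qed

lemma Derivs_graded_finite_basis:
  assumes "is_form d F" "0 < a" "a \<le> d"
  obtains B where "finite B" "B \<subseteq> Derivs_graded F a" "cpoly.independent B"
    "Derivs_graded F a \<subseteq> cpoly.span B" "card B = cpoly.dim (Derivs_graded F a)"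
proof -
  obtain J :: "'a cpoly set" and l
    where J: "finite J" "\<forall>j\<in>J. is_form 1 (l j)" "F = (\<Sum>j\<in>J. l j ^ d)"
    using form_is_sum_of_powers[OF assms(1)] assms(2,3) by (metis less_le_trans)
  have sub: "Derivs_graded F a \<subseteq> cpoly.span ((\<lambda>j. l j ^ a) ` J)"
    using J by (intro Derivs_graded_subset_span_powers[OF _ J(3) assms(2,3)]) auto
  obtain B where B: "B \<subseteq> Derivs_graded F a" "cpoly.independent B"
      "Derivs_graded F a \<subseteq> cpoly.span B" "card B = cpoly.dim (Derivs_graded F a)"
    by (rule cpoly.basis_exists)
  have "finite B"
    using cpoly.independent_span_bound[OF _ B(2) subset_trans[OF B(1) sub]] J(1) by simp
  then show ?thesis using B by (intro that)
qed

section \<open>Forms in independent variables\<close>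

text \<open>
  A derivative of positive order in the variables of one summand kills the other summands, so it
  takes the same value at the summand and at the sum; by any other variable the summand has the
  derivative \<open>0\<close>.
\<close>

lemma Derivs_graded_summand_subset:
  assumes I: "finite I" and disj: "disjoint_family_on X I"
    and form: "\<And>i. i \<in> I \<Longrightarrow> is_form d (Fs i)" and vars: "\<And>i. i \<in> I \<Longrightarrow> cpoly_vars (Fs i) \<subseteq> X i"
    and a: "0 < a" "a < d" and i: "i \<in> I"
  shows "Derivs_graded (Fs i) a \<subseteq> Derivs_graded (\<Sum>i\<in>I. Fs i) a"
proof -
  let ?F = "\<Sum>i\<in>I. Fs i"
  have F: "is_form d ?F" by (intro is_form_sum form)
  have "fold cpoly_pderiv vs (Fs i) \<in> Derivs_graded ?F a" if len: "length vs = d - a" for vs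
  proof (cases "set vs \<subseteq> cpoly_vars (Fs i)")
    case True
    have "vs \<noteq> []" using len a by auto
    then obtain v where v: "v \<in> set vs" by (cases vs) auto
    have "fold cpoly_pderiv vs (Fs i') = 0" if "i' \<in> I - {i}" for i'
    proof (rule fold_pderiv_eq_0)
      have "X i \<inter> X i' = {}" using disjoint_family_onD[OF disj i] that by auto
      moreover have "v \<in> X i" using True vars[OF i] v by blast
      ultimately have "v \<notin> cpoly_vars (Fs i')" using vars[of i'] that by blast
      then show "\<not> set vs \<subseteq> cpoly_vars (Fs i')" using v by blast
    qed
    then have "fold cpoly_pderiv vs ?F = fold cpoly_pderiv vs (Fs i)"
      unfolding fold_pderiv_sum using I i by (simp add: sum.remove[of I i])
    moreover have "fold cpoly_pderiv vs ?F \<in> Derivs_graded ?F a"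
      using is_form_fold_pderiv[OF F, of vs] len a fold_pderiv_in_Derivs
      by (simp add: Derivs_graded_def)
    ultimately show ?thesis by simp
  next
    case False
    then show ?thesis
      by (simp add: fold_pderiv_eq_0 Derivs_graded_def Derivs_def cpoly.span_zero)
  qed
  moreover have "cpoly.subspace (Derivs_graded ?F a)"
    using a by (simp add: Derivs_graded_eq_span[OF F])
  ultimately have "cpoly.span {fold cpoly_pderiv vs (Fs i) | vs. length vs = d - a} \<subseteq> Derivs_graded ?F a"
    by (intro cpoly.span_minimal) blast+
  then show ?thesis
    using Derivs_graded_eq_span[OF form[OF i] a(1)] a(2) by simp
qed

lemma sum_dim_Derivs_graded_le:
  assumes I: "finite I" and disj: "disjoint_family_on X I"
    and form: "\<And>i. i \<in> I \<Longrightarrow> is_form d (Fs i)" and vars: "\<And>i. i \<in> I \<Longrightarrow> cpoly_vars (Fs i) \<subseteq> X i"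
    and a: "0 < a" "a < d"
  shows "(\<Sum>i\<in>I. cpoly.dim (Derivs_graded (Fs i) a)) \<le> cpoly.dim (Derivs_graded (\<Sum>i\<in>I. Fs i) a)"
proof -
  let ?F = "\<Sum>i\<in>I. Fs i"
  have F: "is_form d ?F" by (intro is_form_sum form)
  have "\<exists>B. finite B \<and> B \<subseteq> Derivs_graded (Fs i) a \<and> cpoly.independent B \<and>
      card B = cpoly.dim (Derivs_graded (Fs i) a)" if "i \<in> I" for i
    using Derivs_graded_finite_basis[OF form[OF that] a(1)] a(2) by (metis less_imp_le)
  then obtain B where B: "\<And>i. i \<in> I \<Longrightarrow> finite (B i)"
      "\<And>i. i \<in> I \<Longrightarrow> B i \<subseteq> Derivs_graded (Fs i) a"
      "\<And>i. i \<in> I \<Longrightarrow> cpoly.independent (B i)"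
      "\<And>i. i \<in> I \<Longrightarrow> card (B i) = cpoly.dim (Derivs_graded (Fs i) a)"
    by metis
  have forms: "is_form a b" "cpoly_vars b \<subseteq> X i" if "i \<in> I" "b \<in> B i" for i b
  proof -
    have "b \<in> Derivs_graded (Fs i) a" using B(2) that by blast
    then show "is_form a b" "cpoly_vars b \<subseteq> X i"
      using cpoly_vars_Derivs[of b "Fs i"] vars[OF that(1)] by (auto simp: Derivs_graded_def)
  qed
  have indep: "cpoly.independent (\<Union>i\<in>I. B i)"
    and card: "card (\<Union>i\<in>I. B i) = (\<Sum>i\<in>I. card (B i))"
    by (rule independent_Union_disjoint_vars[OF I disj a(1) B(1) B(3) forms]; assumption)+
  have "(\<Union>i\<in>I. B i) \<subseteq> Derivs_graded ?F a"
    using B(2) Derivs_graded_summand_subset[OF I disj form vars a] by blast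
  moreover obtain C where C: "finite C" "Derivs_graded ?F a \<subseteq> cpoly.span C"
      "card C = cpoly.dim (Derivs_graded ?F a)"
    using Derivs_graded_finite_basis[OF F a(1)] a(2) by (metis less_imp_le)
  ultimately have "card (\<Union>i\<in>I. B i) \<le> cpoly.dim (Derivs_graded ?F a)"
    using cpoly.independent_span_bound[OF C(1) indep] by auto
  then show ?thesis using card B(4) by simp
qed

lemma pderiv_pderiv_sum_eq_0:
  assumes disj: "disjoint_family_on X I" and vars: "\<And>i. i \<in> I \<Longrightarrow> cpoly_vars (Fs i) \<subseteq> X i"
    and i: "i \<in> I" "v \<in> X i" and i': "i' \<in> I" "w \<in> X i'" and ne: "i \<noteq> i'"
  shows "cpoly_pderiv v (cpoly_pderiv w (\<Sum>i\<in>I. Fs i)) = 0"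
proof -
  have "cpoly_pderiv v (cpoly_pderiv w (Fs n)) = 0" if "n \<in> I" for n
  proof -
    have "v \<notin> X n \<or> w \<notin> X n"
      using disjoint_family_onD[OF disj i(1) that] disjoint_family_onD[OF disj i'(1) that] i i' ne
      by blast
    then have "v \<notin> cpoly_vars (Fs n) \<or> w \<notin> cpoly_vars (Fs n)" using vars[OF that] by blast
    then show ?thesis by (metis pderiv_commute pderiv_eq_0 pderiv_0)
  qed
  then show ?thesis by (simp add: pderiv_sum)
qed

lemma linear_form_coeff_nonzero:
  assumes "is_form 1 l" "v \<in> cpoly_vars l"
  shows "Poly_Mapping.lookup l (Poly_Mapping.single v 1) \<noteq> 0"
proof -
  obtain m where m: "Poly_Mapping.lookup l m \<noteq> 0" "v \<in> Poly_Mapping.keys m"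
    using assms(2) by (rule cpoly_varsE)
  let ?n = "m - Poly_Mapping.single v (1::nat)"
  have split: "m = ?n + Poly_Mapping.single v 1" by (rule monomial_split[OF m(2)])
  have "mono_degree (?n + Poly_Mapping.single v 1) = 1"
    using is_formD[OF assms(1) m(1)] split by simp
  then have "?n = 0" by (simp add: mono_degree_add mono_degree_eq_0_iff)
  then show ?thesis using m(1) split by simp
qed

text \<open>
  For \<open>a \<ge> 2\<close> the second derivative of \<open>l ^ a\<close> by two variables of \<open>l\<close> is a nonzero multiple
  of \<open>l ^ (a - 2)\<close>.
\<close>

lemma pderiv_pderiv_power_nonzero:
  assumes l: "is_form 1 l" "v \<in> cpoly_vars l" "w \<in> cpoly_vars l" and a: "2 \<le> a" and nz: "l ^ a \<noteq> 0"
  shows "cpoly_pderiv v (cpoly_pderiv w (l ^ a)) \<noteq> 0"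
proof
  assume 0: "cpoly_pderiv v (cpoly_pderiv w (l ^ a)) = 0"
  have "cpoly_pderiv v (cpoly_pderiv w (l ^ a)) =
    cpoly_scale (of_nat a * Poly_Mapping.lookup l (Poly_Mapping.single w 1) *
      (of_nat (a - 1) * Poly_Mapping.lookup l (Poly_Mapping.single v 1))) (l ^ (a - 1 - 1))"
    by (simp only: pderiv_power_linear_form[OF l(1)] pderiv_scale cpoly.scale_scale)
  then have "l ^ (a - 1 - 1) = 0"
    using 0 a linear_form_coeff_nonzero[OF l(1)] l(2,3) by (auto simp: cpoly.scale_eq_0_iff)
  moreover have "l ^ a = l ^ (a - 1 - 1) * l ^ 2"
    using power_add[of l "a - 1 - 1" 2] a by (metis diff_diff_left le_add_diff_inverse2 one_add_one)
  ultimately show False using nz by simp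
qed

theorem theorem1p9:
  fixes X :: "nat \<Rightarrow> 'v set"
    and Fs :: "nat \<Rightarrow> 'v cpoly"
    and F :: "'v cpoly"
    and k d a :: nat
  assumes "\<And>i. i \<in> {1..k} \<Longrightarrow> finite (X i)"
    and "disjoint_family_on X {1..k}"
    and "\<And>i. i \<in> {1..k} \<Longrightarrow> is_form d (Fs i)"
    and "\<And>i. i \<in> {1..k} \<Longrightarrow> cpoly_vars (Fs i) \<subseteq> X i"
    and "F = (\<Sum>i\<in>{1..k}. Fs i)"
    and "1 \<le> a" and "a \<le> d - 1"
    and "\<And>i. i \<in> {1..k} \<Longrightarrow> waring_rank d (Fs i) = cpoly.dim (Derivs_graded (Fs i) a)"
  shows "waring_rank d F = cpoly.dim (Derivs_graded F a)
    \<and> cpoly.dim (Derivs_graded F a) = (\<Sum>i\<in>{1..k}. waring_rank d (Fs i))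
    \<and> (a \<ge> 2 \<longrightarrow>
        (\<forall>(r::nat) l.
          waring_decomposition d F {1..r} l \<and> (\<forall>j\<in>{1..r}. cpoly_vars (l j) \<subseteq> (\<Union>i\<in>{1..k}. X i))
          \<longrightarrow> (\<forall>j\<in>{1..r}. \<exists>!i. i \<in> {1..k} \<and> cpoly_vars (l j) \<subseteq> X i)
            \<and> (\<forall>i\<in>{1..k}.
                waring_decomposition d (Fs i) {j\<in>{1..r}. cpoly_vars (l j) \<inter> X i \<noteq> {}} l)))"
proof -
  let ?I = "{1..k}"
  note disj = assms(2) and form = assms(3) and vars = assms(4) and rank = assms(8)
  have a: "0 < a" "a < d" "a \<le> d" "0 < d" using assms(6,7) by auto
  have F: "is_form d F" unfolding assms(5) by (intro is_form_sum form)
  have le1: "waring_rank d F \<le> (\<Sum>i\<in>?I. waring_rank d (Fs i))"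
    unfolding assms(5) using form a by (intro waring_rank_sum_le) auto
  have "(\<Sum>i\<in>?I. cpoly.dim (Derivs_graded (Fs i) a)) \<le> cpoly.dim (Derivs_graded F a)"
    unfolding assms(5) by (rule sum_dim_Derivs_graded_le[OF _ disj form vars a(1,2)]) auto
  then have le2: "(\<Sum>i\<in>?I. waring_rank d (Fs i)) \<le> cpoly.dim (Derivs_graded F a)"
    using rank by simp
  have le3: "cpoly.dim (Derivs_graded F a) \<le> waring_rank d F"
    by (rule dim_Derivs_graded_le_waring_rank[OF F a(1,3)])
  have eq1: "waring_rank d F = cpoly.dim (Derivs_graded F a)"
    and eq2: "cpoly.dim (Derivs_graded F a) = (\<Sum>i\<in>?I. waring_rank d (Fs i))"
    using le1 le2 le3 by linarith+
  have "(\<forall>j\<in>{1..r}. \<exists>!i. i \<in> ?I \<and> cpoly_vars (l j) \<subseteq> X i) \<and>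
      (\<forall>i\<in>?I. waring_decomposition d (Fs i) {j\<in>{1..r}. cpoly_vars (l j) \<inter> X i \<noteq> {}} l)"
    if a2: "2 \<le> a" and dec: "waring_decomposition d F {1..r} l"
      and lvars: "\<forall>j\<in>{1..r}. cpoly_vars (l j) \<subseteq> (\<Union>i\<in>?I. X i)" for r :: nat and l
  proof -
    have l: "\<And>j. j \<in> {1..r} \<Longrightarrow> is_form 1 (l j)" and Fl: "F = (\<Sum>j\<in>{1..r}. l j ^ d)"
      and card_r: "card {1..r} = waring_rank d F"
      using dec unfolding waring_decomposition_def by blast+
    from card_r have r: "r = waring_rank d F" by simp
    have sub: "Derivs_graded F a \<subseteq> cpoly.span ((\<lambda>j. l j ^ a) ` {1..r})"
      by (rule Derivs_graded_subset_span_powers[OF l Fl a(1,3)])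
    have subspace: "cpoly.subspace (Derivs_graded F a)"
      by (simp add: Derivs_graded_eq_span[OF F a(1,3)])
    have card: "card {1..r} = cpoly.dim (Derivs_graded F a)" using r eq1 by simp
    have pow: "l j ^ a \<in> Derivs_graded F a" "l j ^ a \<noteq> 0" if "j \<in> {1..r}" for j
      using generators_of_length_dim[OF _ card subspace sub that] by auto
    \<comment> \<open>Without this the tuple of \<open>l j\<close> would not be unique.\<close>
    have ne: "cpoly_vars (l j) \<noteq> {}" if "j \<in> {1..r}" for j
    proof
      assume "cpoly_vars (l j) = {}"
      then have "l j = 0" using cpoly_vars_empty_form[OF l[OF that]] by simp
      then show False using pow(2)[OF that] a(1) by (simp add: zero_power)
    qed
    have one: "cpoly_vars (l j) \<subseteq> X i"
      if j: "j \<in> {1..r}" and i: "i \<in> ?I" and meet: "cpoly_vars (l j) \<inter> X i \<noteq> {}" for i j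
    proof
      fix w assume w: "w \<in> cpoly_vars (l j)"
      obtain v where v: "v \<in> cpoly_vars (l j)" "v \<in> X i" using meet by blast
      obtain i' where i': "i' \<in> ?I" "w \<in> X i'" using lvars j w by blast
      have "i = i'"
      proof (rule ccontr)
        assume "i \<noteq> i'"
        then have "cpoly_pderiv v (cpoly_pderiv w F) = 0"
          unfolding assms(5) by (intro pderiv_pderiv_sum_eq_0[OF disj vars i v(2) i'])
        moreover have "l j ^ a \<in> Derivs F"
          using pow(1)[OF j] by (simp add: Derivs_graded_def)
        ultimately have "cpoly_pderiv v (cpoly_pderiv w (l j ^ a)) = 0"
          by (rule pderiv_pderiv_Derivs_eq_0)
        then show False
          using pderiv_pderiv_power_nonzero[OF l[OF j] v(1) w a2 pow(2)[OF j]] by simp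
      qed
      then show "w \<in> X i" using i'(2) by simp
    qed
    have uniq: "i = i'"
      if "j \<in> {1..r}" "i \<in> ?I" "i' \<in> ?I" "cpoly_vars (l j) \<subseteq> X i" "cpoly_vars (l j) \<inter> X i' \<noteq> {}"
      for i i' j
      using disjoint_family_onD[OF disj that(2,3)] that(4,5) by blast
    have ex1: "\<exists>!i. i \<in> ?I \<and> cpoly_vars (l j) \<subseteq> X i" if j: "j \<in> {1..r}" for j
    proof -
      obtain v where v: "v \<in> cpoly_vars (l j)" using ne[OF j] by blast
      then obtain i where i: "i \<in> ?I" "v \<in> X i" using lvars j by blast
      then have "cpoly_vars (l j) \<subseteq> X i" using one[OF j i(1)] v by blast
      then show ?thesis using i(1) uniq[OF j] v by blast
    qed
    define J where "J i = {j\<in>{1..r}. cpoly_vars (l j) \<inter> X i \<noteq> {}}" for i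
    have finJ: "finite (J i)" for i by (simp add: J_def)
    have "j \<in> (\<Union>i\<in>?I. J i)" if j: "j \<in> {1..r}" for j
    proof -
      obtain i where "i \<in> ?I" "cpoly_vars (l j) \<subseteq> X i" using ex1[OF j] by blast
      then have "j \<in> J i" using ne[OF j] j by (auto simp: J_def Int_absorb2)
      then show ?thesis using \<open>i \<in> ?I\<close> by blast
    qed
    then have JI: "(\<Union>i\<in>?I. J i) = {1..r}" by (auto simp: J_def)
    have disjJ: "J i \<inter> J i' = {}" if i: "i \<in> ?I" "i' \<in> ?I" "i \<noteq> i'" for i i'
    proof (rule equals0I)
      fix j assume "j \<in> J i \<inter> J i'"
      then have j: "j \<in> {1..r}" "cpoly_vars (l j) \<inter> X i \<noteq> {}" "cpoly_vars (l j) \<inter> X i' \<noteq> {}"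
        by (auto simp: J_def)
      show False using uniq[OF j(1) i(1,2) one[OF j(1) i(1) j(2)] j(3)] i(3) by simp
    qed
    have Fi: "Fs i = (\<Sum>j\<in>J i. l j ^ d)" if i: "i \<in> ?I" for i
    proof -
      let ?R = "monomial_part {m. Poly_Mapping.keys m \<subseteq> X i}"
      \<comment> \<open>Both sides of the decomposition of \<open>F\<close> are restricted to the monomials in \<open>X i\<close>.\<close>
      have "?R (Fs i') = (if i' = i then Fs i else 0)" if "i' \<in> ?I" for i'
        using monomial_part_vars_same[OF vars[OF i]]
          monomial_part_vars_disjoint[OF form[OF that] a(4) vars[OF that]]
          disjoint_family_onD[OF disj that i] by auto
      then have "?R F = Fs i"
        unfolding assms(5) monomial_part_sum using i by simp
      moreover have "?R (l j ^ d) = (if j \<in> J i then l j ^ d else 0)" if j: "j \<in> {1..r}" for j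
      proof (cases "j \<in> J i")
        case True
        then have "cpoly_vars (l j ^ d) \<subseteq> X i"
          using one[OF j i] cpoly_vars_power[of "l j" d] by (auto simp: J_def)
        then show ?thesis using True by (simp add: monomial_part_vars_same)
      next
        case False
        then have "cpoly_vars (l j) \<inter> X i = {}" using j by (simp add: J_def)
        then show ?thesis
          using False monomial_part_vars_disjoint[OF is_form_power[OF l[OF j]] a(4) cpoly_vars_power]
          by simp
      qed
      then have "?R F = (\<Sum>j\<in>{1..r}. if j \<in> J i then l j ^ d else 0)"
        unfolding Fl monomial_part_sum by (intro sum.cong) auto
      moreover have "\<dots> = (\<Sum>j\<in>J i. l j ^ d)"
        by (intro sum.mono_neutral_cong_right) (auto simp: J_def)
      ultimately show ?thesis by simp
    qed
    have ge: "waring_rank d (Fs i) \<le> card (J i)" if "i \<in> ?I" for i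
      using l Fi[OF that] finJ by (intro waring_rank_le) (auto simp: J_def)
    have "(\<Sum>i\<in>?I. card (J i)) = card (\<Union>i\<in>?I. J i)"
      using finJ disjJ by (intro card_UN_disjoint[symmetric]) auto
    also have "\<dots> = (\<Sum>i\<in>?I. waring_rank d (Fs i))"
      using JI r eq1 eq2 by simp
    finally have tot: "(\<Sum>i\<in>?I. waring_rank d (Fs i)) = (\<Sum>i\<in>?I. card (J i))" ..
    have "waring_decomposition d (Fs i) (J i) l" if i: "i \<in> ?I" for i
    proof -
      \<comment> \<open>The sums of both sides over \<open>i\<close> agree, and termwise one inequality holds.\<close>
      have "waring_rank d (Fs i) = card (J i)"
        by (rule sum_mono_inv[OF tot ge i]) simp_all
      then show ?thesis
        using l Fi[OF i] finJ by (auto simp: waring_decomposition_def J_def)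
    qed
    then show ?thesis using ex1 unfolding J_def by blast
  qed
  then show ?thesis using eq1 eq2 by blast
qed

end
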